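(* Let $\Omega\subset\mathbb{R}^d$ be a bounded scalable domain, let $U$ be a scalable normed linear space of real-valued functions on $\Omega$ that contains (the restrictions to $\Omega$ of) all real $d$-variate polynomials, let $\lambda\in U^*$ have scaling order $s$, and let $X=\{x_1,\dots,x_M\}\subset\Omega$ be a finite set. Consider a scalable stencil of scaling order $s$ for $\lambda$ based on $X$, with weights $a\in\mathbb{R}^M$ and error functionals $\epsilon_h\in U^*$, $0<h\le 1$. (i) If the stencil is exact on $\mathcal{P}_q^d$ for $q=q_{\max}(\lambda,X)$, then its convergence rate on all polynomials is exactly $q_{\max}(\lambda,X)-s$. (ii) The convergence rate of the stencil on all of $U$ is bounded above by $q_{\max}(\lambda,X)-s$; that is, if $\|\epsilon_h\|_{U^*}\le C h^k$ for some constants $C,k$ and all sufficiently small $h>0$, then $k\le q_{\max}(\lambda,X)-s$.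
   Context: A domain $\Omega\subset\mathbb{R}^d$ is scalable if it contains the origin as an interior point and $h\Omega\subseteq\Omega$ for all $0\le h\le 1$. A space $U$ of functions on a scalable domain is scalable if $u(h\,\cdot)\in U$ for all $u\in U$, $0<h\le 1$. A functional $\lambda\in U^*$ on a scalable space has scaling order $s$ if $\lambda(u(h\,\cdot))=h^s\lambda(u)$ for all $u\in U$, $0<h\le 1$. For $X=\{x_1,\dots,x_M\}$ and $a\in\mathbb{R}^M$ put $\lambda_{a,X}(u)=\sum_{j=1}^M a_j u(x_j)$ and $hX=\{hx_1,\dots,hx_M\}$. The scalable stencil of scaling order $s$ with weights $a$ on $X$ consists of the approximations $\lambda_{ah^{-s},hX}$ to $\lambda$, with error functionals $\epsilon_h(u)=\lambda(u)-h^{-s}\sum_{j=1}^M a_j u(hx_j)=h^{-s}(\lambda-\lambda_{a,X})(u(h\,\cdot))$, $0<h\le 1$. $\mathcal{P}_q^d$ is the space of real $d$-variate polynomials of order at most $q$, i.e. of total degree less than $q$ (dimension $\binom{q+d-1}{d}$). The stencil is exact on $\mathcal{P}_q^d$ if $\lambda-\lambda_{a,X}=0$ on $\mathcal{P}_q^d$. Further, $q_{\max}(\lambda,X)=\max\{q:\ \lambda-\lambda_{a,X}=0\text{ on }\mathcal{P}_q^d\text{ for some }a\in\mathbb{R}^{M}\}$, the maximum being assumed to exist. The convergence rate on all polynomials is exactly $k$ if $|\epsilon_h(p)|=O(h^k)$ as $h\to0$ for every polynomial $p$, and this fails for every larger exponent in place of $k$. *)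

theory Defs
  imports "HOL-Analysis.Analysis" "HOL-Library.Landau_Symbols" "HOL-Library.FuncSet"
begin

definition scalable_domain :: "(real ^ 'd) set \<Rightarrow> bool" where
  "scalable_domain \<Omega> \<longleftrightarrow>
     0 \<in> interior \<Omega> \<and> (\<forall>h. 0 \<le> h \<and> h \<le> 1 \<longrightarrow> (*\<^sub>R) h ` \<Omega> \<subseteq> \<Omega>)"

text \<open>
  A real-valued function on \<open>\<Omega>\<close> is represented by a total function that is
  \<^const>\<open>undefined\<close> outside \<open>\<Omega>\<close> (\<^const>\<open>extensional\<close>), so that equality of
  representatives is equality on \<open>\<Omega>\<close>. The space is given by a carrier \<open>U\<close> and a norm \<open>N\<close>
  that is only meaningful on \<open>U\<close>.
\<close>

locale normed_function_space =
  fixes \<Omega> :: "(real ^ 'd) set"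
    and U :: "(real ^ 'd \<Rightarrow> real) set"
    and N :: "(real ^ 'd \<Rightarrow> real) \<Rightarrow> real"
  assumes carrier: "U \<subseteq> extensional \<Omega>"
    and zero_mem: "(\<lambda>x\<in>\<Omega>. 0) \<in> U"
    and add_mem: "\<lbrakk>u \<in> U; v \<in> U\<rbrakk> \<Longrightarrow> (\<lambda>x\<in>\<Omega>. u x + v x) \<in> U"
    and scale_mem: "u \<in> U \<Longrightarrow> (\<lambda>x\<in>\<Omega>. c * u x) \<in> U"
    and norm_nonneg: "u \<in> U \<Longrightarrow> 0 \<le> N u"
    and norm_eq_zero_iff: "u \<in> U \<Longrightarrow> N u = 0 \<longleftrightarrow> u = (\<lambda>x\<in>\<Omega>. 0)"
    and norm_scale: "u \<in> U \<Longrightarrow> N (\<lambda>x\<in>\<Omega>. c * u x) = \<bar>c\<bar> * N u"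
    and norm_triangle: "\<lbrakk>u \<in> U; v \<in> U\<rbrakk> \<Longrightarrow> N (\<lambda>x\<in>\<Omega>. u x + v x) \<le> N u + N v"

definition dual_space ::
  "(real ^ 'd) set \<Rightarrow> (real ^ 'd \<Rightarrow> real) set \<Rightarrow> ((real ^ 'd \<Rightarrow> real) \<Rightarrow> real)
    \<Rightarrow> ((real ^ 'd \<Rightarrow> real) \<Rightarrow> real) set" where
  "dual_space \<Omega> U N = {\<phi>.
     (\<forall>u\<in>U. \<forall>v\<in>U. \<phi> (\<lambda>x\<in>\<Omega>. u x + v x) = \<phi> u + \<phi> v) \<and>
     (\<forall>c. \<forall>u\<in>U. \<phi> (\<lambda>x\<in>\<Omega>. c * u x) = c * \<phi> u) \<and>
     (\<exists>B. \<forall>u\<in>U. \<bar>\<phi> u\<bar> \<le> B * N u)}"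

text \<open>
  The analogue of \<^const>\<open>onorm\<close> relative to a carrier. As there, the zero function
  contributes \<open>0 / 0 = 0\<close>. The supremum is meaningful for members of \<^const>\<open>dual_space\<close>.
\<close>

definition dual_norm ::
  "(real ^ 'd \<Rightarrow> real) set \<Rightarrow> ((real ^ 'd \<Rightarrow> real) \<Rightarrow> real)
    \<Rightarrow> ((real ^ 'd \<Rightarrow> real) \<Rightarrow> real) \<Rightarrow> real" where
  "dual_norm U N \<phi> = (SUP u\<in>U. \<bar>\<phi> u\<bar> / N u)"

definition dilate :: "(real ^ 'd) set \<Rightarrow> real \<Rightarrow> (real ^ 'd \<Rightarrow> real) \<Rightarrow> real ^ 'd \<Rightarrow> real" where
  "dilate \<Omega> h u = (\<lambda>x\<in>\<Omega>. u (h *\<^sub>R x))"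

definition scalable_space :: "(real ^ 'd) set \<Rightarrow> (real ^ 'd \<Rightarrow> real) set \<Rightarrow> bool" where
  "scalable_space \<Omega> U \<longleftrightarrow> (\<forall>u\<in>U. \<forall>h. 0 < h \<and> h \<le> 1 \<longrightarrow> dilate \<Omega> h u \<in> U)"

definition has_scaling_order ::
  "(real ^ 'd) set \<Rightarrow> (real ^ 'd \<Rightarrow> real) set \<Rightarrow> ((real ^ 'd \<Rightarrow> real) \<Rightarrow> real) \<Rightarrow> real \<Rightarrow> bool" where
  "has_scaling_order \<Omega> U \<phi> s \<longleftrightarrow>
     (\<forall>u\<in>U. \<forall>h. 0 < h \<and> h \<le> 1 \<longrightarrow> \<phi> (dilate \<Omega> h u) = h powr s * \<phi> u)"

definition point_functional ::
  "nat \<Rightarrow> (nat \<Rightarrow> real) \<Rightarrow> (nat \<Rightarrow> real ^ 'd) \<Rightarrow> (real ^ 'd \<Rightarrow> real) \<Rightarrow> real" where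
  "point_functional M a x u = (\<Sum>j=1..M. a j * u (x j))"

definition stencil_error ::
  "((real ^ 'd \<Rightarrow> real) \<Rightarrow> real) \<Rightarrow> real \<Rightarrow> nat \<Rightarrow> (nat \<Rightarrow> real) \<Rightarrow> (nat \<Rightarrow> real ^ 'd)
    \<Rightarrow> real \<Rightarrow> (real ^ 'd \<Rightarrow> real) \<Rightarrow> real" where
  "stencil_error \<phi> s M a x h u =
     \<phi> u - point_functional M (\<lambda>j. a j * h powr (- s)) (\<lambda>j. h *\<^sub>R x j) u"

text \<open>
  The space of \<^emph>\<open>order\<close> at most \<open>q\<close>: polynomial functions of total degree strictly less
  than \<open>q\<close>, so \<open>poly_space 0\<close> contains only the zero function.
\<close>

definition poly_space :: "nat \<Rightarrow> (real ^ 'd \<Rightarrow> real) set" where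
  "poly_space q = {p. \<exists>c. \<forall>x. p x =
     (\<Sum>\<alpha> | (\<Sum>i\<in>UNIV. \<alpha> i) < q. c \<alpha> * (\<Prod>i\<in>UNIV. (x $ i) ^ \<alpha> i))}"

lemma finite_exponents: "finite {\<alpha> :: 'd::finite \<Rightarrow> nat. (\<Sum>i\<in>UNIV. \<alpha> i) < q}"
proof (rule finite_subset)
  show "{\<alpha> :: 'd \<Rightarrow> nat. (\<Sum>i\<in>UNIV. \<alpha> i) < q} \<subseteq> PiE UNIV (\<lambda>_. {..<q})"
  proof (clarsimp simp: PiE_UNIV_domain)
    fix \<alpha> :: "'d \<Rightarrow> nat" and i
    assume "(\<Sum>i\<in>UNIV. \<alpha> i) < q"
    moreover have "\<alpha> i \<le> (\<Sum>i\<in>UNIV. \<alpha> i)"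
      by (rule member_le_sum) auto
    ultimately show "\<alpha> i < q" by simp
  qed
  show "finite (PiE (UNIV :: 'd set) (\<lambda>_. {..<q}))"
    by (intro finite_PiE) auto
qed

lemma poly_space_rep:
  fixes p :: "real ^ 'd \<Rightarrow> real"
  assumes "finite I" "\<And>i. i \<in> I \<Longrightarrow> (\<Sum>j\<in>UNIV. e i j) < q"
    and "\<And>x. p x = (\<Sum>i\<in>I. c i * (\<Prod>j\<in>UNIV. (x $ j) ^ e i j))"
  shows "p \<in> poly_space q"
proof -
  let ?E = "{\<alpha> :: 'd \<Rightarrow> nat. (\<Sum>i\<in>UNIV. \<alpha> i) < q}"
  have "p x = (\<Sum>\<alpha>\<in>?E. (\<Sum>i | i \<in> I \<and> e i = \<alpha>. c i) * (\<Prod>j\<in>UNIV. (x $ j) ^ \<alpha> j))" for x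
  proof -
    have "(\<Sum>\<alpha>\<in>?E. (\<Sum>i | i \<in> I \<and> e i = \<alpha>. c i) * (\<Prod>j\<in>UNIV. (x $ j) ^ \<alpha> j))
       = (\<Sum>\<alpha>\<in>?E. \<Sum>i | i \<in> I \<and> e i = \<alpha>. c i * (\<Prod>j\<in>UNIV. (x $ j) ^ e i j))"
      by (simp add: sum_distrib_right)
    also have "\<dots> = (\<Sum>i\<in>I. c i * (\<Prod>j\<in>UNIV. (x $ j) ^ e i j))"
      by (rule sum.group) (use assms finite_exponents in auto)
    finally show ?thesis using assms(3) by simp
  qed
  then show ?thesis
    unfolding poly_space_def mem_Collect_eq
    by (intro exI[of _ "\<lambda>\<alpha>. \<Sum>i | i \<in> I \<and> e i = \<alpha>. c i"] allI)
qed

lemma real_polynomial_function_iff_poly_space: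
  "real_polynomial_function p \<longleftrightarrow> (\<exists>q. p \<in> poly_space q)"
  for p :: "real ^ 'd \<Rightarrow> real"
proof
  assume "real_polynomial_function p"
  then show "\<exists>q. p \<in> poly_space q"
  proof induction
    case (linear f)
    have "f x = (\<Sum>i\<in>UNIV. f (axis i 1) * (\<Prod>j\<in>UNIV. (x $ j) ^ (if j = i then 1 else 0)))" for x
    proof -
      interpret bounded_linear f by fact
      have "f x = f (\<Sum>i\<in>UNIV. x $ i *\<^sub>R axis i 1)"
        by (subst basis_expansion[symmetric]) (simp add: scalar_mult_eq_scaleR)
      also have "\<dots> = (\<Sum>i\<in>UNIV. f (axis i 1) * x $ i)" by (simp add: sum scaleR mult.commute)
      finally show ?thesis by (simp add: if_distrib cong: if_cong)
    qed
    then have "f \<in> poly_space 2"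
      by (rule poly_space_rep[rotated 2]) simp_all
    then show ?case by blast
  next
    case (const c)
    have "(\<lambda>x. c) \<in> poly_space 1"
      by (intro poly_space_rep[where I="{()}" and e="\<lambda>_ _. 0" and c="\<lambda>_. c"]) auto
    then show ?case by blast
  next
    case (add f g)
    then obtain q1 c1 q2 c2 where
      f: "\<And>x. f x = (\<Sum>\<alpha> | (\<Sum>i\<in>UNIV. \<alpha> i) < q1. c1 \<alpha> * (\<Prod>i\<in>UNIV. (x $ i) ^ \<alpha> i))" and
      g: "\<And>x. g x = (\<Sum>\<alpha> | (\<Sum>i\<in>UNIV. \<alpha> i) < q2. c2 \<alpha> * (\<Prod>i\<in>UNIV. (x $ i) ^ \<alpha> i))"
      unfolding poly_space_def by blast
    have "(\<lambda>x. f x + g x) \<in> poly_space (max q1 q2)"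
      by (rule poly_space_rep[where I="{\<alpha>. (\<Sum>i\<in>UNIV. \<alpha> i) < q1} <+> {\<alpha>. (\<Sum>i\<in>UNIV. \<alpha> i) < q2}"
            and e="case_sum id id" and c="case_sum c1 c2"])
         (auto simp: finite_exponents sum.Plus f g)
    then show ?case by blast
  next
    case (mult f g)
    then obtain q1 c1 q2 c2 where
      f: "\<And>x. f x = (\<Sum>\<alpha> | (\<Sum>i\<in>UNIV. \<alpha> i) < q1. c1 \<alpha> * (\<Prod>i\<in>UNIV. (x $ i) ^ \<alpha> i))" and
      g: "\<And>x. g x = (\<Sum>\<alpha> | (\<Sum>i\<in>UNIV. \<alpha> i) < q2. c2 \<alpha> * (\<Prod>i\<in>UNIV. (x $ i) ^ \<alpha> i))"
      unfolding poly_space_def by blast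
    have "(\<lambda>x. f x * g x) \<in> poly_space (q1 + q2)"
    proof (rule poly_space_rep[where I="{\<alpha>. (\<Sum>i\<in>UNIV. \<alpha> i) < q1} \<times> {\<alpha>. (\<Sum>i\<in>UNIV. \<alpha> i) < q2}"
            and e="\<lambda>z j. fst z j + snd z j" and c="\<lambda>z. c1 (fst z) * c2 (snd z)"])
      fix x :: "real ^ 'd"
      show "f x * g x = (\<Sum>z\<in>{\<alpha>. (\<Sum>i\<in>UNIV. \<alpha> i) < q1} \<times> {\<alpha>. (\<Sum>i\<in>UNIV. \<alpha> i) < q2}.
          c1 (fst z) * c2 (snd z) * (\<Prod>j\<in>UNIV. (x $ j) ^ (fst z j + snd z j)))"
        unfolding f g sum_product sum.cartesian_product power_add prod.distrib
        by (rule sum.cong) (simp_all add: case_prod_unfold)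
    qed (auto simp: finite_exponents sum.distrib)
    then show ?case by blast
  qed
next
  assume "\<exists>q. p \<in> poly_space q"
  then obtain q c where
    "p = (\<lambda>x. \<Sum>\<alpha> | (\<Sum>i\<in>UNIV. \<alpha> i) < q. c \<alpha> * (\<Prod>i\<in>UNIV. (x $ i) ^ \<alpha> i))"
    unfolding poly_space_def by blast
  moreover have "real_polynomial_function
      (\<lambda>x::real ^ 'd. c \<alpha> * (\<Prod>i\<in>UNIV. (x $ i) ^ \<alpha> i))" for \<alpha>
    by (rule real_polynomial_function.intros(4), rule real_polynomial_function.intros(2),
        rule real_polynomial_function_prod, simp, rule real_polynomial_function_power,
        rule real_polynomial_function.intros(1), rule bounded_linear_vec_nth)
  ultimately show "real_polynomial_function p"
    by (simp only:) (rule real_polynomial_function_sum[OF finite_exponents])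
qed

definition exact_on_poly_space ::
  "(real ^ 'd) set \<Rightarrow> ((real ^ 'd \<Rightarrow> real) \<Rightarrow> real) \<Rightarrow> nat \<Rightarrow> (nat \<Rightarrow> real)
    \<Rightarrow> (nat \<Rightarrow> real ^ 'd) \<Rightarrow> nat \<Rightarrow> bool" where
  "exact_on_poly_space \<Omega> \<phi> M a x q \<longleftrightarrow>
     (\<forall>p\<in>poly_space q. \<phi> (restrict p \<Omega>) - point_functional M a x (restrict p \<Omega>) = 0)"

definition exactness_orders ::
  "(real ^ 'd) set \<Rightarrow> ((real ^ 'd \<Rightarrow> real) \<Rightarrow> real) \<Rightarrow> nat \<Rightarrow> (nat \<Rightarrow> real ^ 'd) \<Rightarrow> nat set" where
  "exactness_orders \<Omega> \<phi> M x = {q. \<exists>a. exact_on_poly_space \<Omega> \<phi> M a x q}"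

definition q_max ::
  "(real ^ 'd) set \<Rightarrow> ((real ^ 'd \<Rightarrow> real) \<Rightarrow> real) \<Rightarrow> nat \<Rightarrow> (nat \<Rightarrow> real ^ 'd) \<Rightarrow> nat" where
  "q_max \<Omega> \<phi> M x = Max (exactness_orders \<Omega> \<phi> M x)"

definition poly_rate ::
  "(real ^ 'd) set \<Rightarrow> (real \<Rightarrow> (real ^ 'd \<Rightarrow> real) \<Rightarrow> real) \<Rightarrow> real \<Rightarrow> bool" where
  "poly_rate \<Omega> \<epsilon> k \<longleftrightarrow>
     (\<forall>p. real_polynomial_function p \<longrightarrow>
        (\<lambda>h. \<bar>\<epsilon> h (restrict p \<Omega>)\<bar>) \<in> O[at_right 0](\<lambda>h. h powr k))"

definition poly_rate_exactly ::
  "(real ^ 'd) set \<Rightarrow> (real \<Rightarrow> (real ^ 'd \<Rightarrow> real) \<Rightarrow> real) \<Rightarrow> real \<Rightarrow> bool" where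
  "poly_rate_exactly \<Omega> \<epsilon> k \<longleftrightarrow> poly_rate \<Omega> \<epsilon> k \<and> (\<forall>k'>k. \<not> poly_rate \<Omega> \<epsilon> k')"

end

theory Submission
  imports Defs
begin

text \<open>
  On a monomial \<open>p\<close> of degree \<open>m\<close> the scaling order forces
  \<open>\<phi> p = h powr (m - s) * \<phi> p\<close>, hence \<open>\<epsilon>\<^sub>h p = h powr (m - s) * \<epsilon>\<^sub>1 p\<close>.
  A rate better than \<open>q - s\<close> on the monomials of degree at most \<open>q\<close> therefore forces
  \<open>\<epsilon>\<^sub>1\<close> to vanish on them, i.e. exactness on polynomials of order \<open>q + 1\<close>;
  for \<open>q = q_max\<close> this contradicts maximality.
\<close>

section \<open>Monomials as homogeneous generators of the polynomials\<close>

definition monomial :: "('d::finite \<Rightarrow> nat) \<Rightarrow> real ^ 'd \<Rightarrow> real" where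
  "monomial \<alpha> x = (\<Prod>i\<in>UNIV. (x $ i) ^ \<alpha> i)"

lemma monomial_scaleR: "monomial \<alpha> (h *\<^sub>R x) = h ^ (\<Sum>i\<in>UNIV. \<alpha> i) * monomial \<alpha> x"
  by (simp add: monomial_def power_mult_distrib prod.distrib power_sum)

lemma poly_space_iff_monomials:
  "p \<in> poly_space q \<longleftrightarrow>
     (\<exists>c. p = (\<lambda>x. \<Sum>\<alpha> | (\<Sum>i\<in>UNIV. \<alpha> i) < q. c \<alpha> * monomial \<alpha> x))"
  by (simp add: poly_space_def monomial_def fun_eq_iff)

lemma real_polynomial_function_monomial: "real_polynomial_function (monomial \<alpha>)"
proof -
  \<comment> \<open>The order in \<open>poly_space\<close> exceeds the degree strictly, hence the
    \<open>Suc\<close>.\<close>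
  have "monomial \<alpha> \<in> poly_space (Suc (\<Sum>i\<in>UNIV. \<alpha> i))"
    by (rule poly_space_rep[where I="{()}" and e="\<lambda>_. \<alpha>" and c="\<lambda>_. 1"])
       (auto simp: monomial_def)
  then show ?thesis
    using real_polynomial_function_iff_poly_space by blast
qed

section \<open>Bounded linear functionals on the normed function space\<close>

text \<open>Additivity and homogeneity of \<open>\<psi>\<close> are available only on the carrier
  \<open>U\<close>, so the induction has to carry membership of the partial sums along with the
  value of \<open>\<psi>\<close>.\<close>

lemma dual_space_sum:
  assumes "normed_function_space \<Omega> U N" "\<psi> \<in> dual_space \<Omega> U N"
    and "finite I" "\<And>i. i \<in> I \<Longrightarrow> restrict (f i) \<Omega> \<in> U"
  shows "(\<lambda>x\<in>\<Omega>. \<Sum>i\<in>I. c i * f i x) \<in> U \<and>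
    \<psi> (\<lambda>x\<in>\<Omega>. \<Sum>i\<in>I. c i * f i x) = (\<Sum>i\<in>I. c i * \<psi> (restrict (f i) \<Omega>))"
  using assms(3,4)
proof (induction I)
  interpret normed_function_space \<Omega> U N by fact
  note dual = assms(2)[unfolded dual_space_def mem_Collect_eq]
  case empty
  \<comment> \<open>The value at the zero function comes from homogeneity with scalar 0.\<close>
  have "\<psi> (\<lambda>x\<in>\<Omega>. 0 * (\<lambda>x\<in>\<Omega>. 0) x) = 0"
    using dual zero_mem by (metis mult_zero_left)
  then show ?case using zero_mem by (simp only: sum.empty mult_zero_left simp_thms)
next
  interpret normed_function_space \<Omega> U N by fact
  note dual = assms(2)[unfolded dual_space_def mem_Collect_eq]
  case (insert i I)
  define u where "u = (\<lambda>x\<in>\<Omega>. c i * restrict (f i) \<Omega> x)"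
  define v where "v = (\<lambda>x\<in>\<Omega>. \<Sum>i\<in>I. c i * f i x)"
  have fi: "restrict (f i) \<Omega> \<in> U" using insert.prems by blast
  have u: "u \<in> U" "\<psi> u = c i * \<psi> (restrict (f i) \<Omega>)"
    using scale_mem[OF fi] dual fi unfolding u_def by blast+
  have v: "v \<in> U" "\<psi> v = (\<Sum>i\<in>I. c i * \<psi> (restrict (f i) \<Omega>))"
    using insert.IH insert.prems unfolding v_def by blast+
  have "(\<lambda>x\<in>\<Omega>. \<Sum>i\<in>insert i I. c i * f i x) = (\<lambda>x\<in>\<Omega>. u x + v x)"
    using insert.hyps by (auto simp: u_def v_def)
  moreover have "\<psi> (\<lambda>x\<in>\<Omega>. u x + v x) = \<psi> u + \<psi> v"
    using dual u(1) v(1) by blast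
  ultimately show ?case
    using add_mem[OF u(1) v(1)] u(2) v(2) insert.hyps
    by (simp only: sum.insert simp_thms)
qed

text \<open>A real supremum dominates its terms only if they are bounded above; the constant
  \<open>B\<close> from membership in the dual space supplies this. If \<open>N u = 0\<close>, the
  same constant forces \<open>\<psi> u = 0\<close>.\<close>

lemma dual_norm_bound:
  assumes "normed_function_space \<Omega> U N" "\<psi> \<in> dual_space \<Omega> U N" "u \<in> U"
  shows "\<bar>\<psi> u\<bar> \<le> dual_norm U N \<psi> * N u"
proof -
  interpret normed_function_space \<Omega> U N by fact
  obtain B where B: "\<And>v. v \<in> U \<Longrightarrow> \<bar>\<psi> v\<bar> \<le> B * N v"
    using assms(2) unfolding dual_space_def by blast
  show ?thesis
  proof (cases "N u = 0")
    case True
    then show ?thesis using B[OF assms(3)] by simp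
  next
    case False
    \<comment> \<open>The maximum with 0 covers \<open>N v = 0\<close>, where the quotient is 0 by
      convention while \<open>B\<close> might be negative.\<close>
    have "\<bar>\<psi> v\<bar> / N v \<le> max B 0" if "v \<in> U" for v
    proof (cases "N v = 0")
      case False
      then have "0 < N v" using norm_nonneg[OF that] by simp
      then have "\<bar>\<psi> v\<bar> / N v \<le> B" using B[OF that] by (simp add: divide_le_eq)
      then show ?thesis by simp
    qed simp
    then have "bdd_above ((\<lambda>v. \<bar>\<psi> v\<bar> / N v) ` U)"
      unfolding bdd_above_def by blast
    then have "\<bar>\<psi> u\<bar> / N u \<le> dual_norm U N \<psi>"
      unfolding dual_norm_def by (rule cSUP_upper[OF assms(3)])
    moreover have "0 < N u" using norm_nonneg[OF assms(3)] False by simp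
    ultimately show ?thesis by (simp add: divide_le_eq)
  qed
qed

section \<open>Dependence of the error on h for a single monomial\<close>

lemma stencil_error_one:
  "stencil_error \<phi> s M a x 1 u = \<phi> u - point_functional M a x u"
  by (simp add: stencil_error_def)

text \<open>Both terms of the error acquire the same factor. For the point evaluations it is h^m
  from homogeneity times h^(-s) from the weights. For \<open>\<phi>\<close> the identity holds
  because \<open>\<phi>\<close> vanishes on monomials of degree m \<noteq> s, and for m = s the
  factor is 1; the proof treats both cases at once.\<close>

lemma stencil_error_monomial:
  assumes "scalable_domain \<Omega>" "x ` {1..M} \<subseteq> \<Omega>" "has_scaling_order \<Omega> U \<phi> s"
    and "\<phi> \<in> dual_space \<Omega> U N" "restrict (monomial \<alpha>) \<Omega> \<in> U" "0 < h" "h \<le> 1"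
  shows "stencil_error \<phi> s M a x h (restrict (monomial \<alpha>) \<Omega>) =
    h powr (real (\<Sum>i\<in>UNIV. \<alpha> i) - s) * stencil_error \<phi> s M a x 1 (restrict (monomial \<alpha>) \<Omega>)"
proof -
  define m where "m = (\<Sum>i\<in>UNIV. \<alpha> i)"
  define p where "p = restrict (monomial \<alpha>) \<Omega>"
  \<comment> \<open>Scaled points stay in \<Omega>, so the restricted monomial takes its true value
    there and not \<open>undefined\<close>.\<close>
  have mem: "h *\<^sub>R y \<in> \<Omega>" if "y \<in> \<Omega>" for y
    using assms(1,6,7) that unfolding scalable_domain_def
    by (meson image_subset_iff less_eq_real_def)
  have x_mem: "x j \<in> \<Omega>" if "j \<in> {1..M}" for j
    using assms(2) that by blast
  have pow: "h powr (real m - s) = h ^ m * h powr (- s)"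
    using assms(6) by (simp add: powr_diff powr_minus powr_realpow divide_inverse)
  have "dilate \<Omega> h p = (\<lambda>x\<in>\<Omega>. h ^ m * p x)"
    using mem by (auto simp: dilate_def p_def monomial_scaleR m_def)
  moreover have "\<phi> (dilate \<Omega> h p) = h powr s * \<phi> p"
    using assms(3,5-7) unfolding has_scaling_order_def p_def by blast
  moreover have "\<phi> (\<lambda>x\<in>\<Omega>. h ^ m * p x) = h ^ m * \<phi> p"
    using assms(4,5) unfolding dual_space_def p_def by blast
  \<comment> \<open>The dilated monomial is evaluated in two ways: by the scaling order and by
    linearity.\<close>
  ultimately have "h powr s * \<phi> p = h ^ m * \<phi> p" by metis
  moreover have "h powr (- s) * h powr s = 1"
    using assms(6) by (simp add: powr_minus)
  ultimately have \<phi>: "\<phi> p = h powr (real m - s) * \<phi> p"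
    unfolding pow by (metis mult.assoc mult.commute mult_1)
  have "a j * h powr (- s) * p (h *\<^sub>R x j) = h powr (real m - s) * (a j * p (x j))"
    if "j \<in> {1..M}" for j
    unfolding p_def pow using mem x_mem[OF that]
    by (simp add: monomial_scaleR m_def)
  then have pt: "point_functional M (\<lambda>j. a j * h powr (- s)) (\<lambda>j. h *\<^sub>R x j) p =
      h powr (real m - s) * point_functional M a x p"
    unfolding point_functional_def sum_distrib_left by (rule sum.cong[OF refl])
  have "stencil_error \<phi> s M a x h p = h powr (real m - s) * stencil_error \<phi> s M a x 1 p"
    unfolding stencil_error_one stencil_error_def[of _ _ _ _ _ h] pt right_diff_distrib
    using \<phi> by (rule arg_cong[where f="\<lambda>t. t - _"])
  then show ?thesis unfolding m_def p_def .
qed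

text \<open>Dividing the estimate by h^e leaves the constant |b| below C h^(k - e), which tends to
  0.\<close>

lemma scaled_powr_bigo_imp_zero:
  fixes b e k :: real
  assumes "(\<lambda>h. h powr e * b) \<in> O[at_right 0](\<lambda>h. h powr k)" "e < k"
  shows "b = 0"
proof -
  obtain C where C: "\<forall>\<^sub>F h in at_right 0. norm (h powr e * b) \<le> C * norm (h powr k)"
    using assms(1) by (rule landau_o.bigE) blast
  have "\<forall>\<^sub>F h in at_right (0::real). 0 < h"
    by (rule eventually_at_right_less)
  with C have "\<forall>\<^sub>F h in at_right 0. \<bar>b\<bar> \<le> C * h powr (k - e)"
  proof eventually_elim
    case (elim h)
    then have "h powr e * \<bar>b\<bar> \<le> h powr e * (C * h powr (k - e))"
      by (simp add: abs_mult powr_diff)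
    then show ?case using elim(2) by simp
  qed
  moreover have "((\<lambda>h. h powr (k - e)) \<longlongrightarrow> 0) (at_right 0)"
    \<comment> \<open>The base tends to 0, so continuity of \<open>powr\<close> requires a positive
      exponent and a base that is eventually nonnegative.\<close>
    using assms(2) by (auto intro!: tendsto_eq_intros tendsto_powr' simp: eventually_at_filter)
  then have "((\<lambda>h. C * h powr (k - e)) \<longlongrightarrow> 0) (at_right 0)"
    by (rule tendsto_mult_right_zero)
  ultimately have "\<bar>b\<bar> \<le> 0"
    by (intro tendsto_lowerbound) auto
  then show ?thesis by simp
qed

section \<open>Convergence rates on polynomials and in the dual norm\<close>

theorem theorem2:
  fixes \<Omega> :: "(real ^ 'd) set"
    and U :: "(real ^ 'd \<Rightarrow> real) set"
    and N :: "(real ^ 'd \<Rightarrow> real) \<Rightarrow> real"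
    and \<phi> :: "(real ^ 'd \<Rightarrow> real) \<Rightarrow> real"
    and s :: real
    and M :: nat
    and x :: "nat \<Rightarrow> real ^ 'd"
    and a :: "nat \<Rightarrow> real"
  assumes "bounded \<Omega>"
    and "scalable_domain \<Omega>"
    and "normed_function_space \<Omega> U N"
    and "scalable_space \<Omega> U"
    and "\<And>p. real_polynomial_function p \<Longrightarrow> restrict p \<Omega> \<in> U"
    and "\<phi> \<in> dual_space \<Omega> U N"
    and "has_scaling_order \<Omega> U \<phi> s"
    and "x ` {1..M} \<subseteq> \<Omega>"
    and "\<exists>m \<in> exactness_orders \<Omega> \<phi> M x. \<forall>q \<in> exactness_orders \<Omega> \<phi> M x. q \<le> m"
    and "\<And>h. 0 < h \<Longrightarrow> h \<le> 1 \<Longrightarrow> stencil_error \<phi> s M a x h \<in> dual_space \<Omega> U N"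
  shows "(exact_on_poly_space \<Omega> \<phi> M a x (q_max \<Omega> \<phi> M x) \<longrightarrow>
            poly_rate_exactly \<Omega> (stencil_error \<phi> s M a x) (real (q_max \<Omega> \<phi> M x) - s))
       \<and> (\<forall>C k. (\<forall>\<^sub>F h in at_right 0.
                    dual_norm U N (stencil_error \<phi> s M a x h) \<le> C * h powr k)
              \<longrightarrow> k \<le> real (q_max \<Omega> \<phi> M x) - s)"
proof -
  interpret normed_function_space \<Omega> U N by fact
  define E where "E = stencil_error \<phi> s M a x"
  define Q where "Q = q_max \<Omega> \<phi> M x"
  have mono_mem: "restrict (monomial \<alpha>) \<Omega> \<in> U" for \<alpha>
    by (rule assms(5)) (rule real_polynomial_function_monomial)
  have E_mono: "E h (restrict (monomial \<alpha>) \<Omega>) =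
      h powr (real (\<Sum>i\<in>UNIV. \<alpha> i) - s) * E 1 (restrict (monomial \<alpha>) \<Omega>)"
    if "0 < h" "h \<le> 1" for h \<alpha>
    unfolding E_def by (rule stencil_error_monomial[OF assms(2,8,7,6) mono_mem that])
  have small: "\<forall>\<^sub>F h in at_right (0::real). 0 < h \<and> h \<le> 1"
    by (rule eventually_at_rightI[of 0 1]) auto
  have E_sum: "E h (\<lambda>x\<in>\<Omega>. \<Sum>\<alpha>\<in>I. c \<alpha> * monomial \<alpha> x) =
      (\<Sum>\<alpha>\<in>I. c \<alpha> * E h (restrict (monomial \<alpha>) \<Omega>))"
    if "finite I" "0 < h" "h \<le> 1" for h c I
    using dual_space_sum[OF assms(3) assms(10)[OF that(2,3)] that(1) mono_mem] by (simp add: E_def)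
  have exact_iff: "exact_on_poly_space \<Omega> \<phi> M a x q \<longleftrightarrow> (\<forall>p\<in>poly_space q. E 1 (restrict p \<Omega>) = 0)" for q
    by (simp add: exact_on_poly_space_def E_def stencil_error_one)
  have not_exact: "\<not> exact_on_poly_space \<Omega> \<phi> M a x (Suc Q)"
  proof
    assume "exact_on_poly_space \<Omega> \<phi> M a x (Suc Q)"
    then have mem: "Suc Q \<in> exactness_orders \<Omega> \<phi> M x"
      unfolding exactness_orders_def by blast
    \<comment> \<open>\<open>Max\<close> is an upper bound only on finite sets; the assumed maximum
      bounds this set of naturals and so makes it finite.\<close>
    have "finite (exactness_orders \<Omega> \<phi> M x)"
      using assms(9) by (meson finite_nat_set_iff_bounded_le)
    then have "Suc Q \<le> Q" using mem unfolding Q_def q_max_def by (rule Max_ge)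
    then show False by simp
  qed
  \<comment> \<open>Common core of both upper bounds: a rate k on each monomial separately suffices,
    and a rate on polynomials as well as one in the dual norm yields it.\<close>
  have slow: "k \<le> real Q - s"
    if rate: "\<And>\<alpha>. (\<lambda>h. E h (restrict (monomial \<alpha>) \<Omega>)) \<in> O[at_right 0](\<lambda>h. h powr k)" for k
  proof (rule ccontr)
    assume k: "\<not> k \<le> real Q - s"
    have E1: "E 1 (restrict (monomial \<alpha>) \<Omega>) = 0" if "(\<Sum>i\<in>UNIV. \<alpha> i) < Suc Q" for \<alpha>
    proof (rule scaled_powr_bigo_imp_zero)
      \<comment> \<open>The degree is at most Q, and Q - s < k by the negated claim.\<close>
      show "real (\<Sum>i\<in>UNIV. \<alpha> i) - s < k" using that k by linarith
      have "\<forall>\<^sub>F h in at_right 0. E h (restrict (monomial \<alpha>) \<Omega>) =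
          h powr (real (\<Sum>i\<in>UNIV. \<alpha> i) - s) * E 1 (restrict (monomial \<alpha>) \<Omega>)"
        using small by eventually_elim (rule E_mono; simp)
      then show "(\<lambda>h. h powr (real (\<Sum>i\<in>UNIV. \<alpha> i) - s) * E 1 (restrict (monomial \<alpha>) \<Omega>))
          \<in> O[at_right 0](\<lambda>h. h powr k)"
        by (rule landau_o.big.in_cong[THEN iffD1, OF _ rate])
    qed
    have "exact_on_poly_space \<Omega> \<phi> M a x (Suc Q)"
      unfolding exact_iff
    proof
      fix p :: "real ^ 'd \<Rightarrow> real"
      assume "p \<in> poly_space (Suc Q)"
      then obtain c where
        "p = (\<lambda>x. \<Sum>\<alpha> | (\<Sum>i\<in>UNIV. \<alpha> i) < Suc Q. c \<alpha> * monomial \<alpha> x)"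
        unfolding poly_space_iff_monomials by blast
      then have "E 1 (restrict p \<Omega>) =
          (\<Sum>\<alpha> | (\<Sum>i\<in>UNIV. \<alpha> i) < Suc Q. c \<alpha> * E 1 (restrict (monomial \<alpha>) \<Omega>))"
        using E_sum[OF finite_exponents] by simp
      then show "E 1 (restrict p \<Omega>) = 0" using E1 by simp
    qed
    with not_exact show False by contradiction
  qed
  have "poly_rate_exactly \<Omega> E (real Q - s)" if exact: "exact_on_poly_space \<Omega> \<phi> M a x Q"
    unfolding poly_rate_exactly_def
  proof (intro conjI allI impI notI)
    show "poly_rate \<Omega> E (real Q - s)"
      unfolding poly_rate_def
    proof (intro allI impI)
      fix p :: "real ^ 'd \<Rightarrow> real"
      assume "real_polynomial_function p"
      then obtain q c where p:
        "p = (\<lambda>x. \<Sum>\<alpha> | (\<Sum>i\<in>UNIV. \<alpha> i) < q. c \<alpha> * monomial \<alpha> x)"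
        unfolding real_polynomial_function_iff_poly_space poly_space_iff_monomials by blast
      \<comment> \<open>The error on p as a finite combination of powers of h, valid for 0 < h \<le>
        1, so that each power can be estimated separately.\<close>
      let ?t = "\<lambda>h. \<Sum>\<alpha> | (\<Sum>i\<in>UNIV. \<alpha> i) < q. c \<alpha> *
          (h powr (real (\<Sum>i\<in>UNIV. \<alpha> i) - s) * E 1 (restrict (monomial \<alpha>) \<Omega>))"
      have "\<forall>\<^sub>F h in at_right 0. E h (restrict p \<Omega>) = ?t h"
        using small
      proof eventually_elim
        case (elim h)
        then have h: "0 < h" "h \<le> 1" by auto
        show ?case
          unfolding p E_sum[OF finite_exponents h] E_mono[OF h] ..
      qed
      moreover have "?t \<in> O[at_right 0](\<lambda>h. h powr (real Q - s))"
      proof (rule big_sum_in_bigo)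
        fix \<alpha> :: "'d \<Rightarrow> nat"
        let ?m = "\<Sum>i\<in>UNIV. \<alpha> i"
        show "(\<lambda>h. c \<alpha> * (h powr (real ?m - s) * E 1 (restrict (monomial \<alpha>) \<Omega>)))
            \<in> O[at_right 0](\<lambda>h. h powr (real Q - s))"
        \<comment> \<open>Below degree Q exactness removes the term; from degree Q on, h^(m - s)
          \<le> h^(Q - s) because h \<le> 1.\<close>
        proof (cases "?m < Q")
          case True
          then have "monomial \<alpha> \<in> poly_space Q"
            by (intro poly_space_rep[where I="{()}" and e="\<lambda>_. \<alpha>" and c="\<lambda>_. 1"])
               (auto simp: monomial_def)
          then show ?thesis using exact unfolding exact_iff by simp
        next
          case False
          have "\<forall>\<^sub>F h in at_right 0. norm (h powr (real ?m - s)) \<le> 1 * norm (h powr (real Q - s))"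
            using small
          proof eventually_elim
            case (elim h)
            then show ?case using False by (simp add: powr_mono' del: of_nat_sum)
          qed
          then have "(\<lambda>h. h powr (real ?m - s)) \<in> O[at_right 0](\<lambda>h. h powr (real Q - s))"
            by (rule bigoI)
          then have "(\<lambda>h. (c \<alpha> * E 1 (restrict (monomial \<alpha>) \<Omega>)) * h powr (real ?m - s))
              \<in> O[at_right 0](\<lambda>h. h powr (real Q - s))"
            by simp
          then show ?thesis by (simp add: mult_ac)
        qed
      qed
      ultimately have "(\<lambda>h. E h (restrict p \<Omega>)) \<in> O[at_right 0](\<lambda>h. h powr (real Q - s))"
        by (rule landau_o.big.in_cong[THEN iffD2])
      then show "(\<lambda>h. \<bar>E h (restrict p \<Omega>)\<bar>) \<in> O[at_right 0](\<lambda>h. h powr (real Q - s))"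
        by simp
    qed
  next
    fix k
    assume k: "real Q - s < k" and rate: "poly_rate \<Omega> E k"
    have "k \<le> real Q - s"
    proof (rule slow)
      fix \<alpha> :: "'d \<Rightarrow> nat"
      have "(\<lambda>h. \<bar>E h (restrict (monomial \<alpha>) \<Omega>)\<bar>) \<in> O[at_right 0](\<lambda>h. h powr k)"
        using rate real_polynomial_function_monomial unfolding poly_rate_def by blast
      then show "(\<lambda>h. E h (restrict (monomial \<alpha>) \<Omega>)) \<in> O[at_right 0](\<lambda>h. h powr k)"
        by simp
    qed
    with k show False by simp
  qed
  moreover have "k \<le> real Q - s"
    if bound: "\<forall>\<^sub>F h in at_right 0. dual_norm U N (E h) \<le> C * h powr k" for C k
  proof (rule slow)
    fix \<alpha> :: "'d \<Rightarrow> nat"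
    let ?u = "restrict (monomial \<alpha>) \<Omega>"
    \<comment> \<open>The monomial is fixed, so its norm does not depend on h and is absorbed into
      the constant.\<close>
    have "\<forall>\<^sub>F h in at_right 0. norm (E h ?u) \<le> (C * N ?u) * norm (h powr k)"
      using bound small
    proof eventually_elim
      case (elim h)
      then have "\<bar>E h ?u\<bar> \<le> dual_norm U N (E h) * N ?u"
        using dual_norm_bound[OF assms(3) assms(10) mono_mem] by (simp add: E_def)
      also have "\<dots> \<le> (C * h powr k) * N ?u"
        using elim norm_nonneg[OF mono_mem] by (intro mult_right_mono) auto
      finally show ?case by (simp add: mult_ac)
    qed
    then show "(\<lambda>h. E h ?u) \<in> O[at_right 0](\<lambda>h. h powr k)" by (rule bigoI)
  qed
  ultimately show ?thesis unfolding E_def Q_def by blast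
qed

end
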